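(* There is an absolute constant $C>0$ such that the following holds. Assume $1/\epsilon \geq C\sqrt{\log(1/\delta)}$ and $n \geq \lceil 64\epsilon^{-1}\sqrt{\log(1/\delta)}\rceil$. Let $S$ be a sketching matrix with $n$ columns such that, in the turnstile model (arbitrary $x\in\mathbb{R}^n$), from $Sx$ one succeeds with probability at least $1-\delta$ in returning a set containing all the $\epsilon$ $\ell_1$-heavy hitters of $x$ and containing no item which is not an $(\epsilon/2)$ $\ell_1$-heavy hitter. Then $S$ has $\Omega(\epsilon^{-1}\sqrt{\log(1/\delta)})$ rows.
   Context: $x_i$ is an $\epsilon$ $\ell_1$-heavy hitter if $|x_i|\geq \epsilon\|x\|_1$. In the turnstile model no sign constraint is imposed on the coordinates of $x$.
   Formalization: The failure probability is assumed to satisfy 0 < δ ≤ 1/2; without a bound away from 1 the claim fails, since for 1−δ ≤ 2^{-n} a random guess of the output set succeeds with no rows at all. *)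

theory Defs
  imports "HOL-Probability.Probability"
begin

text \<open>
  Vectors in \<open>\<real>\<^sup>n\<close> are functions \<open>nat \<Rightarrow> real\<close> read at the indices below \<open>n\<close>, and
  \<open>r \<times> n\<close> matrices are functions on \<open>{..<r} \<times> {..<n}\<close>, so that \<open>n\<close> and \<open>r\<close> can be
  quantified inside a formula.
\<close>

definition l1_norm :: "nat \<Rightarrow> (nat \<Rightarrow> real) \<Rightarrow> real" where
  "l1_norm n x = (\<Sum>j<n. \<bar>x j\<bar>)"

definition l1_heavy_hitters :: "nat \<Rightarrow> real \<Rightarrow> (nat \<Rightarrow> real) \<Rightarrow> nat set" where
  "l1_heavy_hitters n \<epsilon> x = {i \<in> {..<n}. \<bar>x i\<bar> \<ge> \<epsilon> * l1_norm n x}"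

definition vec_space :: "nat \<Rightarrow> (nat \<Rightarrow> real) measure" where
  "vec_space r = PiM {..<r} (\<lambda>_. borel)"

definition mat_space :: "nat \<Rightarrow> nat \<Rightarrow> (nat \<times> nat \<Rightarrow> real) measure" where
  "mat_space r n = PiM ({..<r} \<times> {..<n}) (\<lambda>_. borel)"

definition sketch :: "nat \<Rightarrow> nat \<Rightarrow> (nat \<times> nat \<Rightarrow> real) \<Rightarrow> (nat \<Rightarrow> real) \<Rightarrow> (nat \<Rightarrow> real)" where
  "sketch r n S x = (\<lambda>k\<in>{..<r}. \<Sum>j<n. S (k, j) * x j)"

text \<open>
  \<open>P\<close> is the joint law of the random sketching matrix \<open>S\<close> and of a real seed \<open>u\<close> holding any
  further randomness of the recovery procedure \<open>D\<close>; a deterministic recovery procedure ignores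
  \<open>u\<close>. The procedure knows \<open>S\<close> and \<open>u\<close> and accesses \<open>x\<close> only through \<open>S x\<close>. The law \<open>P\<close> is
  fixed before the input \<open>x\<close>, which is an arbitrary real vector (turnstile model).

  Joint measurability of \<open>D\<close> is essential: if only the success event of each single \<open>x\<close> were
  required to be measurable, then under the continuum hypothesis a non-measurable \<open>D\<close> could
  recover every \<open>x\<close> almost surely from a single Gaussian row.
\<close>

definition l1_heavy_hitters_sketch ::
  "nat \<Rightarrow> nat \<Rightarrow> real \<Rightarrow> real \<Rightarrow> ((nat \<times> nat \<Rightarrow> real) \<times> real) measure
    \<Rightarrow> ((nat \<times> nat \<Rightarrow> real) \<Rightarrow> real \<Rightarrow> (nat \<Rightarrow> real) \<Rightarrow> nat set) \<Rightarrow> bool" where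
  "l1_heavy_hitters_sketch r n \<epsilon> \<delta> P D \<longleftrightarrow>
     prob_space P \<and>
     sets P = sets (mat_space r n \<Otimes>\<^sub>M borel) \<and>
     (\<lambda>((S, u), y). D S u y)
       \<in> (mat_space r n \<Otimes>\<^sub>M borel) \<Otimes>\<^sub>M vec_space r \<rightarrow>\<^sub>M count_space (Pow {..<n}) \<and>
     (\<forall>x. measure P {(S, u) \<in> space P.
             l1_heavy_hitters n \<epsilon> x \<subseteq> D S u (sketch r n S x) \<and>
             D S u (sketch r n S x) \<subseteq> l1_heavy_hitters n (\<epsilon> / 2) x} \<ge> 1 - \<delta>)"

end

theory Submission
  imports Defs
begin

text \<open>
  Put \<open>L = sqrt (ln (1 / \<delta>))\<close> and test the sketch on a standard Gaussian vector \<open>x\<close> supported on the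
  first \<open>m \<approx> A / \<epsilon>\<close> coordinates, where \<open>A = max 32 (L / 22)\<close>; by Fubini some fixed \<open>(S, u)\<close> fails
  with probability at most \<open>\<delta>\<close>. Let \<open>P\<close> be the orthogonal projection onto the kernel of \<open>S\<close>. The
  \<open>m\<close> vectors \<open>x + t P e\<^sub>j\<close> with \<open>t = 11 A\<close> have the same sketch, hence the same answer. If \<open>S\<close> has
  few rows, then for most \<open>j\<close> the coordinate \<open>j\<close> is \<open>\<epsilon>\<close>-heavy in \<open>x + t P e\<^sub>j\<close>. As no vector has more
  than \<open>2 / \<epsilon>\<close> coordinates that are \<open>\<epsilon> / 2\<close>-heavy, the common answer is wrong for most of the shifts.

  On the other hand the uniform mixture of the shifted Gaussians has a density \<open>\<rho>\<close> with respect to the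
  unshifted one, so it fails with probability at most \<open>sqrt (\<delta> E \<rho>\<^sup>2)\<close>, where \<open>E \<rho>\<^sup>2\<close> is the average of
  \<open>exp (t\<^sup>2 P i j)\<close>. For large \<open>L\<close> one has \<open>t = L / 2\<close>, and the bound \<open>E \<rho>\<^sup>2 \<le> exp (t\<^sup>2)\<close> suffices. For
  bounded \<open>L\<close>, where \<open>\<delta>\<close> may be as large as \<open>1 / 2\<close>, the entries of \<open>P\<close> are small on average, which
  makes \<open>E \<rho>\<^sup>2\<close> close to 1 once \<open>m\<close> is large; this is where \<open>1 / \<epsilon> \<ge> C L\<close> enters.
\<close>

section \<open>Orthogonal projections\<close>

text \<open>Gram-Schmidt on the rows of \<open>S\<close>: each further row removes at most one
  direction from the range of the projection, so the trace, which equals the rank, drops by at most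
  1. The induction starts from the identity.\<close>

lemma ex_kernel_projection:
  fixes S :: "nat \<Rightarrow> nat \<Rightarrow> real"
  shows "\<exists>P. (\<forall>i j. P i j = P j i) \<and> (\<forall>i<m. \<forall>j<m. (\<Sum>k<m. P i k * P k j) = P i j)
    \<and> (\<forall>k<r. \<forall>j<m. (\<Sum>i<m. S k i * P i j) = 0) \<and> (\<Sum>i<m. P i i) \<ge> real m - real r"
proof (induction r)
  case 0
  show ?case
  proof (intro exI[of _ "\<lambda>i j. if i = j then 1 else 0 :: real"] conjI allI impI)
    fix i j assume "i < m" "j < m"
    have "(\<Sum>k<m. (if i = k then 1 else 0) * (if k = j then 1 else 0 :: real)) =
      (\<Sum>k<m. if k = i then (if i = j then 1 else 0) else 0)"
      by (rule sum.cong) auto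
    then show "(\<Sum>k<m. (if i = k then 1 else 0) * (if k = j then 1 else 0 :: real)) =
      (if i = j then 1 else 0)"
      using \<open>i < m\<close> by simp
  qed auto
next
  case (Suc r)
  then obtain P where sym: "\<And>i j. P i j = P j i"
    and idem: "\<And>i j. i < m \<Longrightarrow> j < m \<Longrightarrow> (\<Sum>k<m. P i k * P k j) = P i j"
    and ker: "\<And>k j. k < r \<Longrightarrow> j < m \<Longrightarrow> (\<Sum>i<m. S k i * P i j) = 0"
    and tr: "(\<Sum>i<m. P i i) \<ge> real m - real r"
    by blast
  define w where "w i = (\<Sum>j<m. P i j * S r j)" for i
  have sP: "(\<Sum>i<m. S r i * P i j) = w j" for j
    unfolding w_def by (simp add: sym[of _ j] mult.commute)
  define q where "q = (\<Sum>i<m. w i * w i)"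
  show ?case
  proof (cases "q = 0")
    \<comment> \<open>The new row is orthogonal to the range of \<open>P\<close>, so
      \<open>P\<close> serves again.\<close>
    case True
    then have "w i * w i = 0" if "i < m" for i
      using that unfolding q_def by (subst (asm) sum_nonneg_eq_0_iff) auto
    then have "(\<Sum>i<m. S r i * P i j) = 0" if "j < m" for j
      using that sP by simp
    then show ?thesis
      using sym idem ker tr by (intro exI[of _ P]) (auto simp: less_Suc_eq)
  next
    case False
    have Pw: "(\<Sum>k<m. P i k * w k) = w i" if "i < m" for i
    proof -
      have "(\<Sum>k<m. P i k * w k) = (\<Sum>j<m. \<Sum>k<m. P i k * P k j * S r j)"
        unfolding w_def sum_distrib_left by (subst sum.swap) (simp add: mult.assoc)
      also have "\<dots> = (\<Sum>j<m. P i j * S r j)"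
        using idem that by (simp flip: sum_distrib_right)
      finally show ?thesis by (simp add: w_def)
    qed
    have Sw: "(\<Sum>i<m. S k i * w i) = 0" if "k < r" for k
    proof -
      have "(\<Sum>i<m. S k i * w i) = (\<Sum>j<m. \<Sum>i<m. S k i * P i j * S r j)"
        unfolding w_def sum_distrib_left by (subst sum.swap) (simp add: mult.assoc)
      also have "\<dots> = 0"
        using ker that by (simp flip: sum_distrib_right)
      finally show ?thesis .
    qed
    \<comment> \<open>As \<open>P\<close> is symmetric and idempotent, the inner product of the new
      row with its projection \<open>w\<close> is the squared norm of \<open>w\<close>. This is why
      the correction by \<open>w i * w j / q\<close> cancels the new row exactly.\<close>
    have sw: "(\<Sum>i<m. S r i * w i) = q"
    proof -
      have "q = (\<Sum>i<m. \<Sum>j<m. w i * P i j * S r j)"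
        unfolding q_def by (subst (2) w_def) (simp add: sum_distrib_left mult.assoc)
      also have "\<dots> = (\<Sum>j<m. \<Sum>i<m. w i * P i j * S r j)"
        by (rule sum.swap)
      also have "\<dots> = (\<Sum>j<m. w j * S r j)"
      proof (intro sum.cong refl)
        fix j assume "j \<in> {..<m}"
        then have "w j = (\<Sum>i<m. w i * P i j)"
          using Pw[of j] by (simp add: sym[of j] mult.commute)
        then show "(\<Sum>i<m. w i * P i j * S r j) = w j * S r j"
          by (simp flip: sum_distrib_right)
      qed
      finally show ?thesis by (simp add: mult.commute)
    qed
    \<comment> \<open>\<open>w\<close> is the projection of the new row, which is removed from the range of \<open>P\<close>.\<close>
    define Q where "Q i j = P i j - w i * w j / q" for i j
    have "Q i j = Q j i" for i j
      by (simp add: Q_def sym mult.commute)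
    moreover have "(\<Sum>k<m. Q i k * Q k j) = Q i j" if "i < m" "j < m" for i j
    proof -
      have "Q i k * Q k j = P i k * P k j - P i k * w k * (w j / q) - P j k * w k * (w i / q)
        + w k * w k * (w i * w j / q\<^sup>2)" for k
        using False by (simp add: Q_def sym[of j k] field_simps power2_eq_square)
      then have "(\<Sum>k<m. Q i k * Q k j) = (\<Sum>k<m. P i k * P k j) - (\<Sum>k<m. P i k * w k) * (w j / q)
        - (\<Sum>k<m. P j k * w k) * (w i / q) + q * (w i * w j / q\<^sup>2)"
        by (simp only: sum.distrib sum_subtractf sum_distrib_right q_def)
      also have "\<dots> = Q i j"
        using that False by (simp add: idem Pw Q_def power2_eq_square)
      finally show ?thesis .
    qed
    moreover have "(\<Sum>i<m. S k i * Q i j) = 0" if "k < Suc r" "j < m" for k j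
    proof -
      have "(\<Sum>i<m. S k i * Q i j) = (\<Sum>i<m. S k i * P i j) - (\<Sum>i<m. S k i * w i) * (w j / q)"
        unfolding Q_def sum_distrib_right sum_subtractf[symmetric]
        by (intro sum.cong refl) (simp add: algebra_simps)
      then show ?thesis
        using that False by (auto simp: less_Suc_eq ker Sw sP sw)
    qed
    moreover have "(\<Sum>i<m. Q i i) = (\<Sum>i<m. P i i) - (\<Sum>i<m. w i * w i) / q"
      by (simp add: Q_def sum_subtractf sum_divide_distrib)
    ultimately show ?thesis
      using tr False by (intro exI[of _ Q]) (auto simp flip: q_def)
  qed
qed

section \<open>Gaussian shifts\<close>

abbreviation std_normal :: "real measure" where
  "std_normal \<equiv> density lborel (\<lambda>x. ennreal (std_normal_density x))"

abbreviation std_gaussian :: "'i set \<Rightarrow> ('i \<Rightarrow> real) measure" where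
  "std_gaussian I \<equiv> PiM I (\<lambda>_. std_normal)"

lemma prob_space_std_normal: "prob_space std_normal"
  by (rule prob_space_normal_density) simp

interpretation std_gaussian: product_prob_space "\<lambda>_. std_normal" I for I :: "'i set"
  by (intro product_prob_space.intro product_prob_space_axioms.intro product_sigma_finite.intro
      prob_space_imp_sigma_finite prob_space_std_normal)

lemma prob_space_std_gaussian: "prob_space (std_gaussian I)"
  by (rule prob_space_PiM) (rule prob_space_std_normal)

lemma sets_std_gaussian [measurable_cong]: "sets (std_gaussian I) = sets (PiM I (\<lambda>_. borel))"
  by (intro sets_PiM_cong) auto

text \<open>Cameron-Martin in dimension one: the exponential factor is the density of the normal law
  with mean \<open>a\<close> relative to the standard one, and translating by \<open>a\<close>
  undoes the shift.\<close>

lemma nn_integral_std_normal_shift: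
  fixes a :: real
  assumes [measurable]: "f \<in> borel_measurable borel"
  shows "(\<integral>\<^sup>+x. f (x - a) * ennreal (exp (a * x - a\<^sup>2 / 2)) \<partial>std_normal) = (\<integral>\<^sup>+x. f x \<partial>std_normal)"
proof -
  have *: "exp (- (x + a)\<^sup>2 / 2) * exp (a * (x + a) - a\<^sup>2 / 2) = exp (- x\<^sup>2 / 2)" for x :: real
    by (simp add: power2_eq_square field_simps flip: exp_add)
  have **: "std_normal_density (a + x) * exp (a * (a + x) - a\<^sup>2 / 2) = std_normal_density x" for x
    unfolding std_normal_density_def using *[of x] by (simp add: add.commute)
  have "(\<integral>\<^sup>+x. f (x - a) * ennreal (exp (a * x - a\<^sup>2 / 2)) \<partial>std_normal) =
    (\<integral>\<^sup>+x. ennreal (std_normal_density x * exp (a * x - a\<^sup>2 / 2)) * f (x - a) \<partial>lborel)"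
    by (subst nn_integral_density) (auto simp: ennreal_mult mult_ac)
  also have "\<dots> = (\<integral>\<^sup>+x. ennreal (std_normal_density x) * f x \<partial>lborel)"
    by (subst nn_integral_real_affine[where c = 1 and t = a]) (auto simp: **)
  finally show ?thesis
    by (subst nn_integral_density) auto
qed

text \<open>The Cameron-Martin density of the Gaussian with mean \<open>v\<close> and identity
  covariance relative to the standard Gaussian, written as a product so that integrals factor over
  the coordinates.\<close>

definition gaussian_tilt :: "'i set \<Rightarrow> ('i \<Rightarrow> real) \<Rightarrow> ('i \<Rightarrow> real) \<Rightarrow> real" where
  "gaussian_tilt I v x = (\<Prod>i\<in>I. exp (v i * x i - (v i)\<^sup>2 / 2))"

lemma gaussian_tilt_nonneg [simp]: "0 \<le> gaussian_tilt I v x"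
  by (simp add: gaussian_tilt_def prod_nonneg)

lemma measurable_gaussian_tilt [measurable]:
  "gaussian_tilt I v \<in> borel_measurable (PiM I (\<lambda>_. borel))"
  unfolding gaussian_tilt_def by measurable

text \<open>The product measure is determined by its values on boxes, and on a box the integral
  factors into one-dimensional shifts.\<close>

lemma std_gaussian_tilt_shift:
  assumes [simp]: "finite I"
  shows "distr (density (std_gaussian I) (gaussian_tilt I v)) (std_gaussian I)
    (\<lambda>x. \<lambda>i\<in>I. x i - v i) = std_gaussian I"
proof (rule std_gaussian.PiM_eqI)
  fix A :: "'a \<Rightarrow> real set" assume A: "\<And>i. i \<in> I \<Longrightarrow> A i \<in> sets std_normal"
  then have [measurable]: "Pi\<^sub>E I A \<in> sets (std_gaussian I)"
    by (intro sets_PiM_I_finite) auto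
  have shift [measurable]: "(\<lambda>x. \<lambda>i\<in>I. x i - v i) \<in> std_gaussian I \<rightarrow>\<^sub>M std_gaussian I"
    by measurable
  have "emeasure (distr (density (std_gaussian I) (gaussian_tilt I v)) (std_gaussian I)
      (\<lambda>x. \<lambda>i\<in>I. x i - v i)) (Pi\<^sub>E I A)
    = (\<integral>\<^sup>+x. indicator (Pi\<^sub>E I A) (\<lambda>i\<in>I. x i - v i) * ennreal (gaussian_tilt I v x) \<partial>std_gaussian I)"
    by (simp flip: nn_integral_indicator add: nn_integral_distr nn_integral_density mult.commute)
  also have "\<dots> = (\<integral>\<^sup>+x. (\<Prod>i\<in>I. indicator (A i) (x i - v i) *
      ennreal (exp (v i * x i - (v i)\<^sup>2 / 2))) \<partial>std_gaussian I)"
  proof (intro nn_integral_cong)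
    fix x
    have "indicator (Pi\<^sub>E I A) (\<lambda>i\<in>I. x i - v i) = (\<Prod>i\<in>I. indicator (A i) (x i - v i) :: ennreal)"
    proof (cases "\<forall>i\<in>I. x i - v i \<in> A i")
      case False
      then show ?thesis
        by (subst prod_zero) (auto simp: indicator_def PiE_def Pi_def)
    qed (auto simp: indicator_def)
    then show "indicator (Pi\<^sub>E I A) (\<lambda>i\<in>I. x i - v i) * ennreal (gaussian_tilt I v x) =
      (\<Prod>i\<in>I. indicator (A i) (x i - v i) * ennreal (exp (v i * x i - (v i)\<^sup>2 / 2)))"
      by (simp add: gaussian_tilt_def prod.distrib prod_ennreal)
  qed
  also have "\<dots> = (\<Prod>i\<in>I. \<integral>\<^sup>+x. indicator (A i) (x - v i) *
      ennreal (exp (v i * x - (v i)\<^sup>2 / 2)) \<partial>std_normal)"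
    using A by (intro std_gaussian.product_nn_integral_prod) auto
  also have "\<dots> = (\<Prod>i\<in>I. emeasure std_normal (A i))"
    using A by (intro prod.cong refl) (simp add: nn_integral_std_normal_shift)
  finally show "emeasure (distr (density (std_gaussian I) (gaussian_tilt I v)) (std_gaussian I)
      (\<lambda>x. \<lambda>i\<in>I. x i - v i)) (Pi\<^sub>E I A) = (\<Prod>i\<in>I. emeasure std_normal (A i))" .
qed auto

lemma nn_integral_std_gaussian_shift:
  assumes [simp]: "finite I" and f [measurable]: "f \<in> borel_measurable (std_gaussian I)"
  shows "(\<integral>\<^sup>+x. f (\<lambda>i\<in>I. x i + v i) \<partial>std_gaussian I) =
    (\<integral>\<^sup>+x. f x * ennreal (gaussian_tilt I v x) \<partial>std_gaussian I)"
proof -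
  have "(\<integral>\<^sup>+x. f (\<lambda>i\<in>I. x i + v i) \<partial>std_gaussian I) =
    (\<integral>\<^sup>+x. f (\<lambda>i\<in>I. x i + v i) \<partial>distr (density (std_gaussian I) (gaussian_tilt I v)) (std_gaussian I)
      (\<lambda>x. \<lambda>i\<in>I. x i - v i))"
    by (simp add: std_gaussian_tilt_shift)
  also have "\<dots> = (\<integral>\<^sup>+x. ennreal (gaussian_tilt I v x) *
      f (\<lambda>i\<in>I. (\<lambda>i\<in>I. x i - v i) i + v i) \<partial>std_gaussian I)"
    by (subst nn_integral_distr, measurable) (subst nn_integral_density, auto)
  also have "\<dots> = (\<integral>\<^sup>+x. f x * ennreal (gaussian_tilt I v x) \<partial>std_gaussian I)"
  proof (intro nn_integral_cong)
    fix x assume "x \<in> space (std_gaussian I)"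
    then have "(\<lambda>i\<in>I. (\<lambda>i\<in>I. x i - v i) i + v i) = x"
      by (auto simp: space_PiM PiE_def extensional_def)
    then show "ennreal (gaussian_tilt I v x) * f (\<lambda>i\<in>I. (\<lambda>i\<in>I. x i - v i) i + v i) =
      f x * ennreal (gaussian_tilt I v x)"
      by (simp add: mult.commute)
  qed
  finally show ?thesis .
qed

text \<open>Completing the square, the tilts by \<open>v\<close> and \<open>w\<close> multiply to a
  constant times the tilt by \<open>v + w\<close>, which integrates to 1. Second moments of mixtures
  of shifts thus depend only on the Gram matrix of the shifts.\<close>

lemma nn_integral_gaussian_tilt_mult:
  assumes [simp]: "finite I"
  shows "(\<integral>\<^sup>+x. ennreal (gaussian_tilt I v x * gaussian_tilt I w x) \<partial>std_gaussian I) =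
    ennreal (exp (\<Sum>i\<in>I. v i * w i))"
proof -
  have *: "exp (v i * y - (v i)\<^sup>2 / 2) * exp (w i * y - (w i)\<^sup>2 / 2) =
    exp (v i * w i) * exp ((v i + w i) * y - (v i + w i)\<^sup>2 / 2)" for i y
    by (simp add: power2_eq_square field_simps flip: exp_add)
  have "(\<integral>\<^sup>+x. ennreal (gaussian_tilt I v x * gaussian_tilt I w x) \<partial>std_gaussian I) =
    (\<integral>\<^sup>+x. (\<Prod>i\<in>I. ennreal (exp (v i * w i) * exp ((v i + w i) * x i - (v i + w i)\<^sup>2 / 2)))
      \<partial>std_gaussian I)"
    by (simp add: gaussian_tilt_def prod_ennreal * flip: prod.distrib)
  also have "\<dots> = (\<Prod>i\<in>I. \<integral>\<^sup>+y. ennreal (exp (v i * w i) *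
      exp ((v i + w i) * y - (v i + w i)\<^sup>2 / 2)) \<partial>std_normal)"
    by (intro std_gaussian.product_nn_integral_prod) auto
  also have "\<dots> = (\<Prod>i\<in>I. ennreal (exp (v i * w i)))"
  proof (intro prod.cong refl)
    fix i
    have "(\<integral>\<^sup>+y. ennreal (exp ((v i + w i) * y - (v i + w i)\<^sup>2 / 2)) \<partial>std_normal) = 1"
      using nn_integral_std_normal_shift[of "\<lambda>_. 1" "v i + w i"]
        prob_space.emeasure_space_1[OF prob_space_std_normal] by simp
    then show "(\<integral>\<^sup>+y. ennreal (exp (v i * w i) * exp ((v i + w i) * y - (v i + w i)\<^sup>2 / 2))
      \<partial>std_normal) = ennreal (exp (v i * w i))"
      by (simp add: ennreal_mult nn_integral_cmult)
  qed
  finally show ?thesis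
    by (simp add: prod_ennreal exp_sum)
qed

lemma nn_integral_std_gaussian_sum_squares:
  assumes [simp]: "finite I"
  shows "(\<integral>\<^sup>+x. ennreal (\<Sum>i\<in>I. (x i)\<^sup>2) \<partial>std_gaussian I) = ennreal (card I)"
proof -
  have 1: "(\<integral>\<^sup>+y. ennreal (y\<^sup>2) \<partial>std_normal) = 1"
  proof -
    have "(\<integral>\<^sup>+y. ennreal (y\<^sup>2) \<partial>std_normal) = (\<integral>\<^sup>+y. ennreal (std_normal_density y * y ^ (2 * 1)) \<partial>lborel)"
      by (subst nn_integral_density) (auto simp: ennreal_mult)
    also have "\<dots> = 1"
      using std_normal_moment_even[of 1]
      by (subst nn_integral_eq_integral) (auto simp: has_bochner_integral_iff fact_numeral)
    finally show ?thesis .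
  qed
  have "(\<integral>\<^sup>+x. ennreal ((x i)\<^sup>2) \<partial>std_gaussian I) = 1" if "i \<in> I" for i
  proof -
    have "(\<integral>\<^sup>+x. ennreal ((x i)\<^sup>2) \<partial>std_gaussian I) =
      (\<integral>\<^sup>+y. ennreal (y\<^sup>2) \<partial>distr (std_gaussian I) std_normal (\<lambda>x. x i))"
      using that by (subst nn_integral_distr) auto
    then show ?thesis
      using std_gaussian.PiM_component[of i I] that 1 by simp
  qed
  then show ?thesis
    by (simp add: nn_integral_sum ennreal_of_nat_eq_real_of_nat flip: sum_ennreal)
qed

section \<open>Heavy hitters\<close>

text \<open>Averaging: every fixed input succeeds with probability at least
  \<open>1 - \<delta>\<close>, so by Fubini some fixed outcome of the sketch and seed succeeds on
  random inputs with at least that probability. \<open>F\<close> is its set of failures.\<close>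

lemma exists_good_sketch:
  assumes sk: "l1_heavy_hitters_sketch r n \<epsilon> \<delta> P D" and M: "prob_space M"
    and X: "\<And>j. j < n \<Longrightarrow> (\<lambda>x. X x j) \<in> borel_measurable M"
  obtains S u F where "F \<in> sets M" "measure M F \<le> \<delta>"
    "\<And>x. x \<in> space M - F \<Longrightarrow> l1_heavy_hitters n \<epsilon> (X x) \<subseteq> D S u (sketch r n S (X x)) \<and>
       D S u (sketch r n S (X x)) \<subseteq> l1_heavy_hitters n (\<epsilon> / 2) (X x)"
proof -
  let ?N = "mat_space r n \<Otimes>\<^sub>M (borel :: real measure)"
  from sk have "prob_space P" and sets_P [measurable_cong]: "sets P = sets ?N"
    and D: "(\<lambda>((S, u), y). D S u y) \<in> ?N \<Otimes>\<^sub>M vec_space r \<rightarrow>\<^sub>M count_space (Pow {..<n})"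
    and succ: "\<And>x. measure P {(S, u) \<in> space P. l1_heavy_hitters n \<epsilon> x \<subseteq> D S u (sketch r n S x) \<and>
             D S u (sketch r n S x) \<subseteq> l1_heavy_hitters n (\<epsilon> / 2) x} \<ge> 1 - \<delta>"
    by (auto simp: l1_heavy_hitters_sketch_def)
  interpret P: prob_space P by fact
  interpret M: prob_space M by fact
  interpret PM: pair_prob_space P M ..
  define out where "out = (\<lambda>\<omega> x. D (fst \<omega>) (snd \<omega>) (sketch r n (fst \<omega>) (X x)))"
  define ok where "ok = (\<lambda>\<omega> x. l1_heavy_hitters n \<epsilon> (X x) \<subseteq> out \<omega> x \<and>
     out \<omega> x \<subseteq> l1_heavy_hitters n (\<epsilon> / 2) (X x))"
  have entry: "(\<lambda>p. fst (fst p) (k, j)) \<in> borel_measurable (P \<Otimes>\<^sub>M M)" if "k < r" "j < n" for k j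
  proof -
    have "(\<lambda>S. S (k, j)) \<in> borel_measurable (mat_space r n)"
      unfolding mat_space_def using that by (intro measurable_component_singleton) auto
    then show ?thesis by measurable
  qed
  have XM: "(\<lambda>p. X (snd p) j) \<in> borel_measurable (P \<Otimes>\<^sub>M M)" if "j < n" for j
    using measurable_compose[OF measurable_snd X[OF that]] .
  have "(\<lambda>p. sketch r n (fst (fst p)) (X (snd p))) \<in> P \<Otimes>\<^sub>M M \<rightarrow>\<^sub>M vec_space r"
    unfolding sketch_def vec_space_def
    using entry XM by (intro measurable_restrict borel_measurable_sum borel_measurable_times) auto
  then have "(\<lambda>p. (fst p, sketch r n (fst (fst p)) (X (snd p)))) \<in> P \<Otimes>\<^sub>M M \<rightarrow>\<^sub>M ?N \<Otimes>\<^sub>M vec_space r"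
    by measurable
  from measurable_compose[OF this D]
  have out: "(\<lambda>p. out (fst p) (snd p)) \<in> P \<Otimes>\<^sub>M M \<rightarrow>\<^sub>M count_space (Pow {..<n})"
    by (simp add: out_def case_prod_beta)
  have out_sub: "out (fst p) (snd p) \<subseteq> {..<n}" if "p \<in> space (P \<Otimes>\<^sub>M M)" for p
    using measurable_space[OF out that] by simp
  have [measurable]: "Measurable.pred (P \<Otimes>\<^sub>M M) (\<lambda>p. i \<in> out (fst p) (snd p))" for i
    by (rule measurable_compose[OF out]) (auto simp: pred_def)
  \<comment> \<open>Success is rewritten as a finite conjunction of measurable conditions on single
    coordinates; indices from \<open>n\<close> on never occur in the output.\<close>
  have "{p \<in> space (P \<Otimes>\<^sub>M M). ok (fst p) (snd p)} =
    {p \<in> space (P \<Otimes>\<^sub>M M). \<forall>i\<in>{..<n}.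
      ((\<epsilon> * (\<Sum>j<n. \<bar>X (snd p) j\<bar>) \<le> \<bar>X (snd p) i\<bar>) \<longrightarrow> i \<in> out (fst p) (snd p)) \<and>
      (i \<in> out (fst p) (snd p) \<longrightarrow> \<epsilon> / 2 * (\<Sum>j<n. \<bar>X (snd p) j\<bar>) \<le> \<bar>X (snd p) i\<bar>)}"
    using out_sub unfolding ok_def l1_heavy_hitters_def l1_norm_def by fastforce
  also have "\<dots> \<in> sets (P \<Otimes>\<^sub>M M)"
  proof (intro sets.sets_Collect_finite_All finite_lessThan)
    fix i assume "i \<in> {..<n}"
    then have [measurable]: "(\<lambda>p. X (snd p) i) \<in> borel_measurable (P \<Otimes>\<^sub>M M)"
      by (intro XM) simp
    have [measurable]: "(\<lambda>p. \<Sum>j<n. \<bar>X (snd p) j\<bar>) \<in> borel_measurable (P \<Otimes>\<^sub>M M)"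
      using XM by (intro borel_measurable_sum borel_measurable_abs) auto
    show "{p \<in> space (P \<Otimes>\<^sub>M M).
      ((\<epsilon> * (\<Sum>j<n. \<bar>X (snd p) j\<bar>) \<le> \<bar>X (snd p) i\<bar>) \<longrightarrow> i \<in> out (fst p) (snd p)) \<and>
      (i \<in> out (fst p) (snd p) \<longrightarrow> \<epsilon> / 2 * (\<Sum>j<n. \<bar>X (snd p) j\<bar>) \<le> \<bar>X (snd p) i\<bar>)} \<in> sets (P \<Otimes>\<^sub>M M)"
      by measurable
  qed
  finally have ok [measurable]: "Measurable.pred (P \<Otimes>\<^sub>M M) (\<lambda>p. ok (fst p) (snd p))"
    by (simp add: pred_def)
  have okM: "{x \<in> space M. ok \<omega> x} \<in> sets M" if "\<omega> \<in> space P" for \<omega>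
    using measurable_compose[OF measurable_Pair1'[OF that] ok] by (simp add: pred_def)
  have okP: "{\<omega> \<in> space P. ok \<omega> x} \<in> sets P" if "x \<in> space M" for x
    using measurable_compose[OF measurable_Pair2'[OF that] ok] by (simp add: pred_def)
  have "\<exists>\<omega>\<in>space P. measure M {x \<in> space M. ok \<omega> x} \<ge> 1 - \<delta>"
  proof (rule ccontr)
    define f where "f \<omega> = measure M {x \<in> space M. ok \<omega> x}" for \<omega>
    assume "\<not> ?thesis"
    then have less: "f \<omega> < 1 - \<delta>" if "\<omega> \<in> space P" for \<omega>
      using that by (auto simp: f_def not_le)
    \<comment> \<open>The probability of \<open>E\<close> is computed in both orders: slicing at
      \<open>x\<close> gives at least \<open>1 - \<delta>\<close>, slicing at
      \<open>\<omega>\<close> gives the mean of \<open>f\<close>, which is strictly smaller.\<close>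
    define E where "E = {p \<in> space (P \<Otimes>\<^sub>M M). ok (fst p) (snd p)}"
    have E [measurable]: "E \<in> sets (P \<Otimes>\<^sub>M M)"
      unfolding E_def by measurable
    have f: "ennreal (f \<omega>) = emeasure M (Pair \<omega> -` E)" if "\<omega> \<in> space P" for \<omega>
    proof -
      have "Pair \<omega> -` E = {x \<in> space M. ok \<omega> x}"
        using that by (auto simp: E_def space_pair_measure)
      then show ?thesis
        by (simp add: f_def M.emeasure_eq_measure)
    qed
    have [measurable]: "f \<in> borel_measurable P"
    proof -
      have "(\<lambda>\<omega>. enn2real (emeasure M (Pair \<omega> -` E))) \<in> borel_measurable P"
        by (intro borel_measurable_enn2real M.measurable_emeasure_Pair E)
      also have "?this \<longleftrightarrow> ?thesis"
        by (intro measurable_cong) (simp add: f_def flip: f)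
      finally show ?thesis .
    qed
    have int: "integrable P f"
      by (rule P.integrable_const_bound[of _ 1]) (auto simp: f_def)
    have "ennreal (1 - \<delta>) = (\<integral>\<^sup>+x. ennreal (1 - \<delta>) \<partial>M)"
      by (simp add: M.emeasure_space_1)
    also have "\<dots> \<le> (\<integral>\<^sup>+x. emeasure P ((\<lambda>\<omega>. (\<omega>, x)) -` E) \<partial>M)"
    proof (intro nn_integral_mono)
      fix x assume "x \<in> space M"
      then have "(\<lambda>\<omega>. (\<omega>, x)) -` E = {(S, u) \<in> space P. l1_heavy_hitters n \<epsilon> (X x) \<subseteq> D S u (sketch r n S (X x)) \<and>
             D S u (sketch r n S (X x)) \<subseteq> l1_heavy_hitters n (\<epsilon> / 2) (X x)}"
        by (auto simp: E_def space_pair_measure ok_def out_def)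
      then show "ennreal (1 - \<delta>) \<le> emeasure P ((\<lambda>\<omega>. (\<omega>, x)) -` E)"
        using succ[of "X x"] by (simp add: P.emeasure_eq_measure ennreal_leI)
    qed
    also have "\<dots> = emeasure (P \<Otimes>\<^sub>M M) E"
      by (rule PM.emeasure_pair_measure_alt2[OF E, symmetric])
    also have "\<dots> = (\<integral>\<^sup>+\<omega>. ennreal (f \<omega>) \<partial>P)"
      by (subst M.emeasure_pair_measure_alt[OF E]) (auto intro!: nn_integral_cong simp: f)
    also have "\<dots> = ennreal (P.expectation f)"
      by (intro nn_integral_eq_integral int) (auto simp: f_def)
    finally have "1 - \<delta> \<le> P.expectation f"
      by (subst (asm) ennreal_le_iff) (auto simp: f_def)
    moreover have "P.expectation f < 1 - \<delta>"
      by (intro P.expectation_less int) (auto intro!: AE_I2 less)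
    ultimately show False by simp
  qed
  then obtain \<omega> where \<omega>: "\<omega> \<in> space P" "measure M {x \<in> space M. ok \<omega> x} \<ge> 1 - \<delta>"
    by blast
  show thesis
  proof (rule that)
    show "{x \<in> space M. \<not> ok \<omega> x} \<in> sets M"
      using sets.compl_sets[OF okM[OF \<omega>(1)]] by (simp add: set_diff_eq conj_commute cong: conj_cong)
    show "measure M {x \<in> space M. \<not> ok \<omega> x} \<le> \<delta>"
      using \<omega>(2) M.prob_neg[OF okM[OF \<omega>(1)]] by simp
  qed (auto simp: ok_def out_def)
qed

section \<open>Counting bounds for heavy hitters\<close>

text \<open>The heavy coordinates together carry at most the whole norm. Positivity of the norm
  excludes the zero vector, all of whose coordinates are heavy.\<close>

lemma card_l1_heavy_hitters_le:
  assumes "0 < \<epsilon>" "0 < l1_norm n x"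
  shows "real (card (l1_heavy_hitters n \<epsilon> x)) \<le> 1 / \<epsilon>"
proof -
  have "real (card (l1_heavy_hitters n \<epsilon> x)) * (\<epsilon> * l1_norm n x) \<le>
    (\<Sum>i\<in>l1_heavy_hitters n \<epsilon> x. \<bar>x i\<bar>)"
    by (rule sum_bounded_below) (simp add: l1_heavy_hitters_def)
  also have "\<dots> \<le> l1_norm n x"
    unfolding l1_norm_def by (rule sum_mono2) (auto simp: l1_heavy_hitters_def)
  finally have "(real (card (l1_heavy_hitters n \<epsilon> x)) * \<epsilon>) * l1_norm n x \<le> 1 * l1_norm n x"
    by (simp add: mult.assoc)
  then show ?thesis
    using assms by (simp add: field_simps)
qed

lemma sum_abs_le_sqrt:
  fixes x :: "'a \<Rightarrow> real"
  shows "(\<Sum>i\<in>A. \<bar>x i\<bar>) \<le> sqrt (card A) * sqrt (\<Sum>i\<in>A. (x i)\<^sup>2)"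
proof -
  have "(\<Sum>i\<in>A. \<bar>x i\<bar>)\<^sup>2 \<le> real (card A) * (\<Sum>i\<in>A. (x i)\<^sup>2)"
    using Cauchy_Schwarz_ineq_sum[of "\<lambda>_. 1" "\<lambda>i. \<bar>x i\<bar>" A] by simp
  then have "(\<Sum>i\<in>A. \<bar>x i\<bar>) \<le> sqrt (real (card A) * (\<Sum>i\<in>A. (x i)\<^sup>2))"
    by (rule real_le_rsqrt)
  then show ?thesis
    by (simp only: real_sqrt_mult)
qed

section \<open>Entries of a projection and the count of shifts\<close>

locale projection_matrix =
  fixes m :: nat and P :: "nat \<Rightarrow> nat \<Rightarrow> real"
  assumes sym: "P i j = P j i"
    and idem: "i < m \<Longrightarrow> j < m \<Longrightarrow> (\<Sum>k<m. P i k * P k j) = P i j"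
begin

lemma sum_row_squares:
  assumes "i < m" shows "(\<Sum>k<m. (P i k)\<^sup>2) = P i i"
proof -
  have "P i k * P k i = (P i k)\<^sup>2" for k
    by (simp add: power2_eq_square sym[of k i])
  then show ?thesis
    using idem[OF assms assms] by simp
qed

lemma diag_bounds:
  assumes "i < m" shows "0 \<le> P i i" "P i i \<le> 1"
proof -
  show nn: "0 \<le> P i i"
    using sum_row_squares[OF assms] by (metis sum_nonneg zero_le_power2)
  have "(P i i)\<^sup>2 \<le> (\<Sum>k<m. (P i k)\<^sup>2)"
    using assms by (intro member_le_sum) auto
  then have "P i i * P i i \<le> 1 * P i i"
    using sum_row_squares[OF assms] by (simp add: power2_eq_square)
  then show "P i i \<le> 1"
    using nn by (cases "P i i = 0") auto
qed

lemma abs_entry_le_1: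
  assumes "i < m" "j < m" shows "\<bar>P i j\<bar> \<le> 1"
proof -
  have "(P i j)\<^sup>2 \<le> (\<Sum>k<m. (P i k)\<^sup>2)"
    using assms by (intro member_le_sum) auto
  also have "\<dots> \<le> 1"
    using assms diag_bounds by (simp add: sum_row_squares)
  finally show ?thesis by (simp add: abs_square_le_1)
qed

text \<open>Rows have Euclidean norm at most 1, so Cauchy-Schwarz applies; the average absolute
  value of an entry is therefore at most \<open>1 / sqrt m\<close>.\<close>

lemma sum_abs_row_le:
  assumes "i < m" shows "(\<Sum>j<m. \<bar>P i j\<bar>) \<le> sqrt m"
proof -
  have "(\<Sum>j<m. \<bar>P i j\<bar>) \<le> sqrt m * sqrt (\<Sum>j<m. (P i j)\<^sup>2)"
    using sum_abs_le_sqrt[of "P i" "{..<m}"] by simp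
  also have "\<dots> \<le> sqrt m * 1"
    using assms diag_bounds by (intro mult_left_mono) (auto simp: sum_row_squares)
  finally show ?thesis by simp
qed

text \<open>Markov's inequality for the nonnegative defects \<open>1 - P i i\<close>, whose sum is
  at most \<open>r\<close>.\<close>

lemma card_small_diag_le:
  assumes "real m - real r \<le> (\<Sum>i<m. P i i)"
  shows "real (card {i \<in> {..<m}. P i i < 1 / 2}) \<le> 2 * real r"
proof -
  let ?N = "{i \<in> {..<m}. P i i < 1 / 2}"
  have "real (card ?N) * (1 / 2) \<le> (\<Sum>i\<in>?N. 1 - P i i)"
    by (rule sum_bounded_below) auto
  also have "\<dots> \<le> (\<Sum>i<m. 1 - P i i)"
    using diag_bounds by (intro sum_mono2) auto
  also have "\<dots> \<le> real r"
    using assms by (simp add: sum_subtractf)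
  finally show ?thesis by simp
qed

text \<open>Two bounds on the second moment of the mixture. The first uses only that entries are at
  most 1. The second linearises the exponential, so that the excess over
  \<open>(real m)\<^sup>2\<close> is of order \<open>m * sqrt m\<close> for fixed
  \<open>t\<close>.\<close>

lemma sum_exp_entries_le:
  "(\<Sum>i<m. \<Sum>j<m. exp (t\<^sup>2 * P i j)) \<le> (real m)\<^sup>2 * exp (t\<^sup>2)" (is ?thesis1)
  "(\<Sum>i<m. \<Sum>j<m. exp (t\<^sup>2 * P i j)) \<le> (real m)\<^sup>2 + t\<^sup>2 * exp (t\<^sup>2) * (real m * sqrt m)" (is ?thesis2)
proof -
  have le: "t\<^sup>2 * P i j \<le> t\<^sup>2" if "i < m" "j < m" for i j
    using abs_entry_le_1[OF that] mult_left_mono[of "P i j" 1 "t\<^sup>2"] by simp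
  have "(\<Sum>i<m. \<Sum>j<m. exp (t\<^sup>2 * P i j)) \<le> (\<Sum>i<m. \<Sum>j<m. exp (t\<^sup>2))"
    using le by (intro sum_mono) auto
  then show ?thesis1 by (simp add: power2_eq_square)
  have "exp (t\<^sup>2 * P i j) \<le> 1 + t\<^sup>2 * exp (t\<^sup>2) * \<bar>P i j\<bar>" if "i < m" "j < m" for i j
  proof (cases "P i j \<le> 0")
    case True
    then have "exp (t\<^sup>2 * P i j) \<le> 1"
      by (simp add: mult_nonneg_nonpos)
    also have "1 \<le> 1 + t\<^sup>2 * exp (t\<^sup>2) * \<bar>P i j\<bar>" by simp
    finally show ?thesis .
  next
    case False
    define a where "a = t\<^sup>2 * P i j"
    have "(1 - a) * exp a \<le> exp (- a) * exp a"
      using exp_ge_add_one_self[of "- a"] by (intro mult_right_mono) auto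
    then have "exp a \<le> 1 + a * exp a"
      by (simp add: algebra_simps flip: exp_add)
    also have "a * exp a \<le> a * exp (t\<^sup>2)"
      using le[OF that] False by (intro mult_left_mono) (auto simp: a_def)
    finally show ?thesis
      using False by (simp add: a_def mult_ac)
  qed
  then have "(\<Sum>i<m. \<Sum>j<m. exp (t\<^sup>2 * P i j)) \<le> (\<Sum>i<m. \<Sum>j<m. 1 + t\<^sup>2 * exp (t\<^sup>2) * \<bar>P i j\<bar>)"
    by (intro sum_mono) auto
  also have "\<dots> = (\<Sum>i<m. real m + t\<^sup>2 * exp (t\<^sup>2) * (\<Sum>j<m. \<bar>P i j\<bar>))"
    by (simp add: sum.distrib sum_distrib_left)
  also have "\<dots> \<le> (\<Sum>i<m. real m + t\<^sup>2 * exp (t\<^sup>2) * sqrt m)"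
    using sum_abs_row_le by (intro sum_mono add_left_mono mult_left_mono) auto
  finally show ?thesis2 by (simp add: power2_eq_square algebra_simps)
qed

text \<open>\<open>B\<close> is the answer shared by all shifts in \<open>T\<close>. Apart from few
  exceptions each \<open>j\<close> in \<open>T\<close> is heavy in its own shift and so lies in
  \<open>B\<close>, while \<open>B\<close> has at most \<open>2 / \<epsilon>\<close> elements
  because it is correct for a single shift. The bound is affine in the squared norm of
  \<open>x\<close>, ready to be integrated.\<close>

lemma card_shifts_le:
  assumes m: "m \<le> n" and tr: "real m - real r \<le> (\<Sum>i<m. P i i)" and \<epsilon>: "0 < \<epsilon>" and t: "8 < t"
    and heavy: "\<epsilon> * (4 * real m + t * sqrt m) \<le> t / 2 - 4"
    and T: "T \<subseteq> {..<m}"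
    and hit: "\<And>j. j \<in> T \<Longrightarrow> l1_heavy_hitters n \<epsilon> (\<lambda>i. if i < m then x i + t * P i j else 0) \<subseteq> B"
    and miss: "\<And>j. j \<in> T \<Longrightarrow> B \<subseteq> l1_heavy_hitters n (\<epsilon> / 2) (\<lambda>i. if i < m then x i + t * P i j else 0)"
  shows "real (card T) \<le> 2 / \<epsilon> + 2 * real r + (\<Sum>i<m. (x i)\<^sup>2) / 8"
proof -
  define s where "s = (\<Sum>i<m. (x i)\<^sup>2)"
  define z where "z j i = (if i < m then x i + t * P i j else 0)" for j i
  have fin: "finite T" using T finite_subset by blast
  have "0 \<le> s" by (simp add: s_def sum_nonneg)
  show ?thesis
  \<comment> \<open>For \<open>s > 16 * real m\<close> the term \<open>s / 8\<close> alone exceeds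
    \<open>m\<close>, hence also \<open>card T\<close>.\<close>
  proof (cases "s \<le> 16 * real m")
    case False
    have "real (card T) \<le> real m"
      using card_mono[OF _ T] by simp
    also have "\<dots> \<le> s / 8" using False \<open>0 \<le> s\<close> by simp
    finally show ?thesis
      using \<epsilon> unfolding s_def[symmetric] by (simp add: add_increasing)
  next
    case True
    \<comment> \<open>The exceptional indices: in \<open>N\<close> the shift moves its own
      coordinate too little, in \<open>L\<close> the coordinate of \<open>x\<close> could cancel the
      shift. The threshold 16 means absolute value 4, whence the bound \<open>t / 2 - 4\<close>
      below.\<close>
    define N where "N = {i \<in> {..<m}. P i i < 1 / 2}"
    define L where "L = {i \<in> {..<m}. 16 < (x i)\<^sup>2}"
    have "real (card L) * 16 \<le> (\<Sum>i\<in>L. (x i)\<^sup>2)"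
      by (rule sum_bounded_below) (auto simp: L_def)
    also have "\<dots> \<le> s"
      unfolding s_def by (rule sum_mono2) (auto simp: L_def)
    finally have L: "real (card L) \<le> s / 16" by simp
    have N: "real (card N) \<le> 2 * real r"
      unfolding N_def by (rule card_small_diag_le[OF tr])
    have z_heavy: "j \<in> l1_heavy_hitters n \<epsilon> (z j) \<and> 0 < l1_norm n (z j)" if j: "j \<in> T - N - L" for j
    proof -
      from j T have jm: "j < m" "1 / 2 \<le> P j j" "(x j)\<^sup>2 \<le> 4\<^sup>2"
        by (auto simp: N_def L_def)
      then have "\<bar>x j\<bar> \<le> 4"
        using abs_le_square_iff[of "x j" 4] by simp
      moreover have "t / 2 \<le> t * P j j"
        using jm t mult_left_mono[of "1/2" "P j j" t] by simp
      ultimately have zj: "t / 2 - 4 \<le> \<bar>z j j\<bar>"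
        using jm by (simp add: z_def)
      have "l1_norm n (z j) = (\<Sum>i<m. \<bar>z j i\<bar>)"
        unfolding l1_norm_def using m by (intro sum.mono_neutral_right) (auto simp: z_def)
      also have "\<dots> \<le> (\<Sum>i<m. \<bar>x i\<bar> + t * \<bar>P j i\<bar>)"
      proof (intro sum_mono)
        fix i assume "i \<in> {..<m}"
        then show "\<bar>z j i\<bar> \<le> \<bar>x i\<bar> + t * \<bar>P j i\<bar>"
          using t abs_triangle_ineq[of "x i" "t * P i j"] by (simp add: z_def sym[of j i] abs_mult)
      qed
      also have "\<dots> = (\<Sum>i<m. \<bar>x i\<bar>) + t * (\<Sum>i<m. \<bar>P j i\<bar>)"
        by (simp add: sum.distrib sum_distrib_left)
      also have "\<dots> \<le> 4 * real m + t * sqrt m"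
      proof (intro add_mono mult_left_mono)
        have "(\<Sum>i<m. \<bar>x i\<bar>) \<le> sqrt m * sqrt s"
          using sum_abs_le_sqrt[of x "{..<m}"] by (simp add: s_def)
        also have "\<dots> \<le> sqrt m * sqrt (16 * real m)"
          using True by (intro mult_left_mono) auto
        finally show "(\<Sum>i<m. \<bar>x i\<bar>) \<le> 4 * real m"
          by (simp add: real_sqrt_mult mult.left_commute[of _ 4])
      qed (use jm t sum_abs_row_le in auto)
      finally have "\<epsilon> * l1_norm n (z j) \<le> \<epsilon> * (4 * real m + t * sqrt m)"
        using \<epsilon> by (intro mult_left_mono) auto
      then have "\<epsilon> * l1_norm n (z j) \<le> \<bar>z j j\<bar>"
        using heavy zj by linarith
      moreover have "\<bar>z j j\<bar> \<le> l1_norm n (z j)"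
        unfolding l1_norm_def using jm m by (intro member_le_sum) auto
      ultimately show ?thesis
        using jm m zj t by (auto simp: l1_heavy_hitters_def)
    qed
    have "real (card (T - N - L)) \<le> 2 / \<epsilon>"
    proof (cases "T - N - L = {}")
      case True
      show ?thesis unfolding True using \<epsilon> by simp
    next
      case False
      then obtain k where k: "k \<in> T - N - L" by blast
      have "T - N - L \<subseteq> B"
        using z_heavy hit unfolding z_def by blast
      also have "B \<subseteq> l1_heavy_hitters n (\<epsilon> / 2) (z k)"
        using miss k unfolding z_def by blast
      finally have "card (T - N - L) \<le> card (l1_heavy_hitters n (\<epsilon> / 2) (z k))"
        by (intro card_mono) (auto simp: l1_heavy_hitters_def)
      also have "real \<dots> \<le> 1 / (\<epsilon> / 2)"
        using z_heavy[OF k] \<epsilon> by (intro card_l1_heavy_hitters_le) auto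
      finally show ?thesis by simp
    qed
    moreover have "card T \<le> card (T - N - L) + card N + card L"
    proof -
      have "card T \<le> card ((T - N - L) \<union> N \<union> L)"
        using fin by (intro card_mono) (auto simp: N_def L_def)
      also have "\<dots> \<le> card ((T - N - L) \<union> N) + card L" by (rule card_Un_le)
      also have "\<dots> \<le> card (T - N - L) + card N + card L" by (simp add: card_Un_le)
      finally show ?thesis .
    qed
    ultimately have "real (card T) \<le> 2 / \<epsilon> + 2 * real r + s / 16"
      using N L by linarith
    then show ?thesis
      using \<open>0 \<le> s\<close> unfolding s_def[symmetric] by linarith
  qed
qed

end

section \<open>Failures under the shifted Gaussians and the resulting tradeoff\<close>

text \<open>Bounds the expected number of shifts that fall into \<open>F\<close>. Each shift is
  traded for its density, and the sum of the densities is controlled on \<open>F\<close> by its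
  second moment.\<close>

lemma nn_integral_sum_indicator_shift_le:
  fixes v :: "'j \<Rightarrow> 'i \<Rightarrow> real"
  assumes [simp]: "finite I" "finite J" and F [measurable]: "F \<in> sets (std_gaussian I)"
    and \<delta>: "measure (std_gaussian I) F \<le> \<delta>" and \<kappa>: "0 < \<kappa>"
  shows "(\<integral>\<^sup>+x. ennreal (\<Sum>j\<in>J. indicator F (\<lambda>i\<in>I. x i + v j i)) \<partial>std_gaussian I) \<le>
    ennreal ((\<kappa> * \<delta> + (\<Sum>j\<in>J. \<Sum>l\<in>J. exp (\<Sum>i\<in>I. v j i * v l i)) / \<kappa>) / 2)"
proof -
  let ?\<rho> = "\<lambda>j. gaussian_tilt I (v j)"
  let ?V = "\<Sum>j\<in>J. \<Sum>l\<in>J. exp (\<Sum>i\<in>I. v j i * v l i)"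
  have shift [measurable]: "(\<lambda>x. \<lambda>i\<in>I. x i + v j i) \<in> std_gaussian I \<rightarrow>\<^sub>M std_gaussian I" for j
    by measurable
  have "(\<integral>\<^sup>+x. ennreal (\<Sum>j\<in>J. indicator F (\<lambda>i\<in>I. x i + v j i)) \<partial>std_gaussian I) =
    (\<Sum>j\<in>J. \<integral>\<^sup>+x. indicator F (\<lambda>i\<in>I. x i + v j i) \<partial>std_gaussian I)"
    by (simp add: nn_integral_sum ennreal_indicator flip: sum_ennreal)
  also have "\<dots> = (\<Sum>j\<in>J. \<integral>\<^sup>+x. indicator F x * ennreal (?\<rho> j x) \<partial>std_gaussian I)"
    by (intro sum.cong refl nn_integral_std_gaussian_shift) auto
  also have "\<dots> = (\<integral>\<^sup>+x. ennreal (indicator F x * (\<Sum>j\<in>J. ?\<rho> j x)) \<partial>std_gaussian I)"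
    by (subst nn_integral_sum[symmetric])
       (auto simp: ennreal_mult ennreal_indicator sum_nonneg simp flip: sum_distrib_left)
  also have "\<dots> \<le> (\<integral>\<^sup>+x. ennreal (\<kappa> / 2) * indicator F x +
      ennreal (1 / (2 * \<kappa>)) * (\<Sum>j\<in>J. \<Sum>l\<in>J. ennreal (?\<rho> j x * ?\<rho> l x)) \<partial>std_gaussian I)"
  proof (intro nn_integral_mono)
    fix x
    define s where "s = (\<Sum>j\<in>J. ?\<rho> j x)"
    \<comment> \<open>AM-GM in place of Cauchy--Schwarz; \<open>\<kappa>\<close> is optimised by the caller.\<close>
    have "0 \<le> (\<kappa> - s)\<^sup>2 / (2 * \<kappa>)"
      using \<kappa> by simp
    also have "\<dots> = \<kappa> / 2 + s\<^sup>2 / (2 * \<kappa>) - s"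
      using \<kappa> by (simp add: power2_eq_square field_simps)
    finally have "indicator F x * s \<le> \<kappa> / 2 * indicator F x + 1 / (2 * \<kappa>) * s\<^sup>2"
      using \<kappa> by (auto simp: indicator_def)
    then have "ennreal (indicator F x * s) \<le> ennreal (\<kappa> / 2 * indicator F x + 1 / (2 * \<kappa>) * s\<^sup>2)"
      by (rule ennreal_leI)
    also have "\<dots> = ennreal (\<kappa> / 2) * indicator F x + ennreal (1 / (2 * \<kappa>)) * ennreal (s\<^sup>2)"
      using \<kappa> by (simp flip: ennreal_plus ennreal_mult ennreal_indicator)
    also have "ennreal (s\<^sup>2) = (\<Sum>j\<in>J. \<Sum>l\<in>J. ennreal (?\<rho> j x * ?\<rho> l x))"
      by (simp add: s_def power2_eq_square sum_product sum_nonneg)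
    finally show "ennreal (indicator F x * (\<Sum>j\<in>J. ?\<rho> j x)) \<le> ennreal (\<kappa> / 2) * indicator F x +
      ennreal (1 / (2 * \<kappa>)) * (\<Sum>j\<in>J. \<Sum>l\<in>J. ennreal (?\<rho> j x * ?\<rho> l x))"
      by (simp add: s_def)
  qed
  also have "\<dots> = ennreal (\<kappa> / 2) * emeasure (std_gaussian I) F + ennreal (1 / (2 * \<kappa>)) *
      (\<Sum>j\<in>J. \<Sum>l\<in>J. ennreal (exp (\<Sum>i\<in>I. v j i * v l i)))"
    by (simp add: nn_integral_add nn_integral_cmult nn_integral_sum nn_integral_gaussian_tilt_mult
        del: sum_ennreal)
  also have "\<dots> = ennreal (\<kappa> / 2 * measure (std_gaussian I) F + 1 / (2 * \<kappa>) * ?V)"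
    using \<kappa> by (simp add: finite_measure.emeasure_eq_measure[OF prob_space.finite_measure[OF
        prob_space_std_gaussian]] sum_nonneg flip: ennreal_mult ennreal_plus)
  also have "\<dots> \<le> ennreal ((\<kappa> * \<delta> + ?V / \<kappa>) / 2)"
    using \<kappa> mult_left_mono[OF \<delta>, of \<kappa>] by (intro ennreal_leI) (simp add: add_divide_distrib mult.commute[of \<kappa> 2])
  finally show ?thesis .
qed

lemma sketch_padded_shift_eq:
  assumes "m \<le> n" "\<And>k. k < r \<Longrightarrow> (\<Sum>i<m. S (k, i) * v i) = 0"
  shows "sketch r n S (\<lambda>i. if i < m then x i + t * v i else 0) =
    sketch r n S (\<lambda>i. if i < m then x i else 0)"
proof -
  have pad: "(\<Sum>i<n. S (k, i) * (if i < m then y i else 0)) = (\<Sum>i<m. S (k, i) * y i)" for k y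
    using assms(1) by (intro sum.mono_neutral_cong_right) auto
  have "(\<Sum>i<m. S (k, i) * (x i + t * v i)) = (\<Sum>i<m. S (k, i) * x i) + t * (\<Sum>i<m. S (k, i) * v i)" for k
    by (simp add: algebra_simps sum.distrib sum_distrib_left)
  then show ?thesis
    using assms(2) by (auto simp: sketch_def pad fun_eq_iff restrict_def)
qed

text \<open>The \<open>m\<close> shifts of \<open>x\<close> are split into those outside
  \<open>F\<close>, counted by \<open>card_shifts_le\<close>, and those inside; then the count is
  integrated over \<open>x\<close>, the squared norm having mean \<open>m\<close>. \<open>V\<close>
  is the second moment of the summed densities; it is existential because it depends on the kernel
  of the chosen sketch.\<close>

lemma heavy_hitters_sketch_tradeoff:
  assumes sk: "l1_heavy_hitters_sketch r n \<epsilon> \<delta> Pr D" and m: "m \<le> n" and \<epsilon>: "0 < \<epsilon>" and t: "8 < t"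
    and heavy: "\<epsilon> * (4 * real m + t * sqrt m) \<le> t / 2 - 4" and \<kappa>: "0 < \<kappa>" and \<delta>: "0 < \<delta>"
  obtains V where "V \<le> (real m)\<^sup>2 * exp (t\<^sup>2)" "V \<le> (real m)\<^sup>2 + t\<^sup>2 * exp (t\<^sup>2) * (real m * sqrt m)"
    "real m \<le> 2 / \<epsilon> + 2 * real r + real m / 8 + (\<kappa> * \<delta> + V / \<kappa>) / 2"
proof -
  let ?\<Gamma> = "std_gaussian {..<m}"
  define X :: "(nat \<Rightarrow> real) \<Rightarrow> nat \<Rightarrow> real" where "X x = (\<lambda>i. if i < m then x i else 0)" for x
  have "(\<lambda>x. X x j) \<in> borel_measurable ?\<Gamma>" for j
    unfolding X_def by (cases "j < m") auto
  then obtain S u F where F [measurable]: "F \<in> sets ?\<Gamma>" and F_le: "measure ?\<Gamma> F \<le> \<delta>"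
    and ok: "\<And>x. x \<in> space ?\<Gamma> - F \<Longrightarrow> l1_heavy_hitters n \<epsilon> (X x) \<subseteq> D S u (sketch r n S (X x)) \<and>
       D S u (sketch r n S (X x)) \<subseteq> l1_heavy_hitters n (\<epsilon> / 2) (X x)"
    using exists_good_sketch[OF sk prob_space_std_gaussian] by metis
  obtain P where P: "\<forall>i j. P i j = P j i" "\<forall>i<m. \<forall>j<m. (\<Sum>k<m. P i k * P k j) = P i j"
    and ker: "\<And>k j. k < r \<Longrightarrow> j < m \<Longrightarrow> (\<Sum>i<m. S (k, i) * P i j) = 0"
    and tr: "real m - real r \<le> (\<Sum>i<m. P i i)"
    using ex_kernel_projection[of m r "\<lambda>k i. S (k, i)"] by blast
  interpret projection_matrix m P
    using P by unfold_locales blast+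
  define V where "V = (\<Sum>i<m. \<Sum>j<m. exp (t\<^sup>2 * P i j))"
  define y where "y j x = (\<lambda>i\<in>{..<m}. x i + t * P i j)" for j and x :: "nat \<Rightarrow> real"
  have [measurable]: "y j \<in> ?\<Gamma> \<rightarrow>\<^sub>M ?\<Gamma>" for j
    unfolding y_def by measurable
  have X_y: "X (y j x) = (\<lambda>i. if i < m then x i + t * P i j else 0)" for j x
    by (auto simp: X_def y_def)
  have split: "real m \<le> 2 / \<epsilon> + 2 * real r + (\<Sum>i<m. (x i)\<^sup>2) / 8 + (\<Sum>j<m. indicator F (y j x))"
    if x: "x \<in> space ?\<Gamma>" for x
  proof -
    define T where "T = {j \<in> {..<m}. y j x \<notin> F}"
    \<comment> \<open>All shifts have the sketch of \<open>x\<close>, so the answer at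
      \<open>X x\<close> serves as \<open>B\<close>, even when \<open>x\<close> itself lies in
      \<open>F\<close>.\<close>
    have same: "sketch r n S (X (y j x)) = sketch r n S (X x)" if "j < m" for j
      unfolding X_y unfolding X_def using that ker m by (intro sketch_padded_shift_eq) auto
    have "y j x \<in> space ?\<Gamma> - F" if "j \<in> T" for j
      using that x by (auto simp: T_def space_PiM y_def)
    then have "real (card T) \<le> 2 / \<epsilon> + 2 * real r + (\<Sum>i<m. (x i)\<^sup>2) / 8"
      using ok same
      by (intro card_shifts_le[OF m tr \<epsilon> t heavy, where B = "D S u (sketch r n S (X x))"])
         (force simp: T_def X_y)+
    moreover have "(\<Sum>j<m. indicator F (y j x)) = real m - real (card T)"
    proof -
      have "(\<Sum>j<m. indicator F (y j x)) = (\<Sum>j<m. 1 - (if y j x \<notin> F then 1 else 0 :: real))"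
        by (intro sum.cong) (auto simp: indicator_def)
      then show ?thesis
        by (simp add: sum_subtractf T_def flip: sum.inter_filter)
    qed
    ultimately show ?thesis by simp
  qed
  have "ennreal (real m) = (\<integral>\<^sup>+x. ennreal (real m) \<partial>?\<Gamma>)"
    by (simp add: prob_space.emeasure_space_1[OF prob_space_std_gaussian])
  also have "\<dots> \<le> (\<integral>\<^sup>+x. ennreal (2 / \<epsilon> + 2 * real r) + ennreal (1 / 8) * ennreal (\<Sum>i<m. (x i)\<^sup>2) +
      ennreal (\<Sum>j<m. indicator F (y j x)) \<partial>?\<Gamma>)"
  proof (intro nn_integral_mono)
    fix x assume "x \<in> space ?\<Gamma>"
    then have "ennreal (real m) \<le> ennreal (2 / \<epsilon> + 2 * real r + 1 / 8 * (\<Sum>i<m. (x i)\<^sup>2) + (\<Sum>j<m. indicator F (y j x)))"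
      using split[of x] by (intro ennreal_leI) auto
    also have "\<dots> = ennreal (2 / \<epsilon> + 2 * real r + 1 / 8 * (\<Sum>i<m. (x i)\<^sup>2)) + ennreal (\<Sum>j<m. indicator F (y j x))"
      using \<epsilon> by (intro ennreal_plus sum_nonneg add_nonneg_nonneg) (auto intro: sum_nonneg)
    also have "ennreal (2 / \<epsilon> + 2 * real r + 1 / 8 * (\<Sum>i<m. (x i)\<^sup>2)) =
      ennreal (2 / \<epsilon> + 2 * real r) + ennreal (1 / 8) * ennreal (\<Sum>i<m. (x i)\<^sup>2)"
      using \<epsilon> by (subst ennreal_plus) (auto simp: sum_nonneg simp flip: ennreal_mult)
    finally show "ennreal (real m) \<le> ennreal (2 / \<epsilon> + 2 * real r) + ennreal (1 / 8) * ennreal (\<Sum>i<m. (x i)\<^sup>2) +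
      ennreal (\<Sum>j<m. indicator F (y j x))" .
  qed
  also have "\<dots> = ennreal (2 / \<epsilon> + 2 * real r) + ennreal (1 / 8) * ennreal (real m) +
      (\<integral>\<^sup>+x. ennreal (\<Sum>j<m. indicator F (y j x)) \<partial>?\<Gamma>)"
    using nn_integral_std_gaussian_sum_squares[of "{..<m}"]
    by (simp add: nn_integral_add nn_integral_cmult prob_space.emeasure_space_1[OF prob_space_std_gaussian] del: sum_ennreal)
  also have "(\<integral>\<^sup>+x. ennreal (\<Sum>j<m. indicator F (y j x)) \<partial>?\<Gamma>) \<le> ennreal ((\<kappa> * \<delta> + V / \<kappa>) / 2)"
  proof -
    \<comment> \<open>By idempotence the Gram matrix of the shifts \<open>t P e_j\<close> is
      \<open>t\<^sup>2\<close> times \<open>P\<close>.\<close>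
    have "(\<Sum>i<m. t * P i j * (t * P i l)) = t\<^sup>2 * P j l" if "j < m" "l < m" for j l
    proof -
      have "t * P i j * (t * P i l) = t\<^sup>2 * (P j i * P i l)" for i
        by (simp add: sym[of i j] power2_eq_square)
      then show ?thesis
        by (simp only: sum_distrib_left[symmetric] idem[OF that])
    qed
    then have "V = (\<Sum>j<m. \<Sum>l<m. exp (\<Sum>i<m. t * P i j * (t * P i l)))"
      by (simp add: V_def)
    then show ?thesis
      using nn_integral_sum_indicator_shift_le[OF _ _ F F_le \<kappa>, of "{..<m}" "\<lambda>j i. t * P i j"]
      by (simp add: y_def)
  qed
  also have "ennreal (2 / \<epsilon> + 2 * real r) + ennreal (1 / 8) * ennreal (real m) + ennreal ((\<kappa> * \<delta> + V / \<kappa>) / 2) =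
    ennreal (2 / \<epsilon> + 2 * real r + real m / 8 + (\<kappa> * \<delta> + V / \<kappa>) / 2)"
    using \<epsilon> \<kappa> \<delta> by (simp add: V_def sum_nonneg flip: ennreal_mult ennreal_plus)
  finally have "ennreal (real m) \<le> ennreal (2 / \<epsilon> + 2 * real r + real m / 8 + (\<kappa> * \<delta> + V / \<kappa>) / 2)"
    by (simp add: add_left_mono)
  then have "real m \<le> 2 / \<epsilon> + 2 * real r + real m / 8 + (\<kappa> * \<delta> + V / \<kappa>) / 2"
    using \<epsilon> \<kappa> \<delta> by (subst (asm) ennreal_le_iff) (auto simp: V_def intro!: sum_nonneg add_nonneg_nonneg divide_nonneg_pos)
  then show thesis
    using that sum_exp_entries_le[of t] by (simp add: V_def)
qed

section \<open>Choice of the parameters\<close>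

text \<open>\<open>K\<close> is the coefficient \<open>t\<^sup>2 * exp (t\<^sup>2)\<close> at
  \<open>t = 352\<close>, the value of \<open>t\<close> used for bounded \<open>L\<close>.\<close>

lemma rows_ge_of_heavy_hitters_sketch:
  fixes \<epsilon> \<delta> K :: real
  assumes K: "K = 352\<^sup>2 * exp (352\<^sup>2)"
    and \<epsilon>: "0 < \<epsilon>" and \<delta>: "0 < \<delta>" "\<delta> \<le> 1 / 2"
    and C: "(10000 + (10 * K)\<^sup>2) * sqrt (ln (1 / \<delta>)) \<le> 1 / \<epsilon>"
    and n: "\<lceil>64 * (1 / \<epsilon>) * sqrt (ln (1 / \<delta>))\<rceil> \<le> int n"
    and sk: "l1_heavy_hitters_sketch r n \<epsilon> \<delta> P D"
  shows "1 / 2200 * (1 / \<epsilon>) * sqrt (ln (1 / \<delta>)) \<le> real r"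
proof (rule ccontr)
  define L where "L = sqrt (ln (1 / \<delta>))"
  define A where "A = max 32 (L / 22)"
  define m where "m = nat \<lceil>A / \<epsilon>\<rceil>"
  define t where "t = 11 * A"
  assume "\<not> ?thesis"
  then have r: "real r < L / (2200 * \<epsilon>)"
    by (simp add: L_def mult.commute)
  have "ln (1 / 2) \<le> 1 / 2 - (1 :: real)"
    by (rule ln_le_minus_one) simp
  moreover have "ln \<delta> \<le> ln (1 / 2)"
    using \<delta> by simp
  ultimately have lnd: "1 / 2 \<le> ln (1 / \<delta>)"
    using \<delta> by (simp add: ln_div)
  then have Lsq: "L\<^sup>2 = ln (1 / \<delta>)"
    by (simp add: L_def)
  have L: "7 / 10 \<le> L"
    unfolding L_def using lnd by (intro real_le_rsqrt) (simp add: power2_eq_square)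
  \<comment> \<open>\<open>\<delta> \<le> 1 / 2\<close> keeps \<open>L\<close> away from 0, so the
    constant 32 is also at most \<open>64 * L\<close>; this matches the factor 64 in the hypothesis
    on \<open>n\<close>.\<close>
  have A: "32 \<le> A" "L \<le> 22 * A" "A \<le> 64 * L"
    using L by (auto simp: A_def)
  have m_ge: "A / \<epsilon> \<le> real m" and m_le: "real m \<le> A / \<epsilon> + 1"
    using A \<epsilon> unfolding m_def by (auto simp: of_nat_nat zero_le_ceiling less_imp_le
      intro!: ceiling_correct order_trans[of _ 0] of_int_ceiling_le_add_one)
  have "A / \<epsilon> \<le> 64 * (1 / \<epsilon>) * L"
    using A(3) \<epsilon> by (simp add: divide_right_mono)
  then have "\<lceil>A / \<epsilon>\<rceil> \<le> int n"
    using n ceiling_mono[of "A / \<epsilon>" "64 * (1 / \<epsilon>) * L"] unfolding L_def by linarith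
  then have mn: "m \<le> n"
    unfolding m_def by linarith
  have C': "(10000 + (10 * K)\<^sup>2) * L \<le> 1 / \<epsilon>"
    using C by (simp add: L_def)
  have "10000 * L \<le> (10000 + (10 * K)\<^sup>2) * L"
    using L by (intro mult_right_mono) auto
  then have "10000 * L \<le> 1 / \<epsilon>"
    using C' by linarith
  then have \<epsilon>L: "\<epsilon> * L \<le> 1 / 10000"
    using \<epsilon> by (simp add: field_simps)
  have "\<epsilon> * (7 / 10) \<le> \<epsilon> * L"
    using L \<epsilon> by (intro mult_left_mono) auto
  then have \<epsilon>_le: "\<epsilon> \<le> 1 / 7000"
    using \<epsilon>L by linarith
  have \<epsilon>A: "\<epsilon> * A \<le> 32 / 7000"
    using \<epsilon> \<epsilon>_le \<epsilon>L by (auto simp: A_def max_def)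
  have \<epsilon>m: "\<epsilon> * real m \<le> A + \<epsilon>"
    using mult_left_mono[OF m_le, of \<epsilon>] \<epsilon> by (simp add: algebra_simps)
  have m_pos: "0 < real m"
    using m_ge A \<epsilon> by (meson divide_pos_pos less_le_trans zero_less_numeral)
  have sqm: "\<epsilon> * sqrt m \<le> 1 / 10"
  proof -
    have "\<epsilon> * (\<epsilon> * real m) \<le> \<epsilon> * A + \<epsilon> * \<epsilon>"
      using mult_left_mono[OF \<epsilon>m, of \<epsilon>] \<epsilon> by (simp add: algebra_simps)
    also have "\<epsilon> * \<epsilon> \<le> (1 / 7000) * 1"
      using \<epsilon> \<epsilon>_le by (intro mult_mono) auto
    finally have "\<epsilon> * (\<epsilon> * real m) \<le> (1 / 10)\<^sup>2"
      using \<epsilon>A by (simp add: power2_eq_square)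
    moreover have "(\<epsilon> * sqrt m)\<^sup>2 = \<epsilon> * (\<epsilon> * real m)"
      by (simp add: power_mult_distrib power2_eq_square)
    ultimately show ?thesis
      by (metis power2_le_imp_le zero_le_divide_1_iff zero_le_numeral)
  qed
  have t8: "8 < t"
    using A by (simp add: t_def)
  have "t * (\<epsilon> * sqrt m) \<le> t * (1 / 10)"
    using sqm t8 by (intro mult_left_mono) auto
  moreover have "\<epsilon> * (4 * real m + t * sqrt m) = 4 * (\<epsilon> * real m) + t * (\<epsilon> * sqrt m)"
    by (simp add: algebra_simps)
  \<comment> \<open>Since \<open>t = 11 * A\<close>, the right side is \<open>5.5 A - 4\<close>,
    while the left side is at most \<open>4 A + 4 \<epsilon> + 1.1 A\<close>;
    \<open>A \<ge> 32\<close> leaves enough room.\<close>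
  ultimately have heavy: "\<epsilon> * (4 * real m + t * sqrt m) \<le> t / 2 - 4"
    using \<epsilon>m \<epsilon>_le A(1) t_def by linarith
  \<comment> \<open>\<open>A \<ge> 32\<close> gives the share 1/16, and
    \<open>L \<le> 22 * A\<close> turns the constant 2200 into 1/100 for \<open>r\<close>, so 1/50
    for \<open>2 * real r\<close>.\<close>
  have small: "2 / \<epsilon> + 2 * real r \<le> (1 / 16 + 1 / 50) * real m"
  proof -
    define q where "q = A / \<epsilon>"
    have "2 / \<epsilon> \<le> 1 / 16 * q" "L / (2200 * \<epsilon>) \<le> 1 / 100 * q"
      using A \<epsilon> by (simp_all add: q_def field_simps)
    then show ?thesis
      using m_ge[folded q_def] r by (simp add: distrib_right)
  qed
  \<comment> \<open>With \<open>\<kappa> = m \<theta>\<close> the shares of \<open>m\<close> in the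
    tradeoff add up to at most 1/16 + 1/50 + 1/8 + 3/4, which is less than 1.\<close>
  have contra: False if "0 < \<theta>" "\<theta> * \<delta> + b / \<theta> \<le> 3 / 2"
    and "\<And>V. V \<le> (real m)\<^sup>2 * exp (t\<^sup>2) \<Longrightarrow> V \<le> (real m)\<^sup>2 + t\<^sup>2 * exp (t\<^sup>2) * (real m * sqrt m) \<Longrightarrow>
      V \<le> (real m)\<^sup>2 * b" for \<theta> b
  proof -
    have "0 < real m * \<theta>"
      using m_pos that by simp
    from heavy_hitters_sketch_tradeoff[OF sk mn \<epsilon> t8 heavy this \<delta>(1)] obtain V
      where V: "V \<le> (real m)\<^sup>2 * exp (t\<^sup>2)" "V \<le> (real m)\<^sup>2 + t\<^sup>2 * exp (t\<^sup>2) * (real m * sqrt m)"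
      and le: "real m \<le> 2 / \<epsilon> + 2 * real r + real m / 8 + (real m * \<theta> * \<delta> + V / (real m * \<theta>)) / 2"
      by blast
    define w where "w = real m * \<theta> * \<delta> + V / (real m * \<theta>)"
    have "V / (real m * \<theta>) \<le> (real m)\<^sup>2 * b / (real m * \<theta>)"
      using that V m_pos by (intro divide_right_mono) auto
    also have "\<dots> = real m * (b / \<theta>)"
      using m_pos by (simp add: power2_eq_square)
    finally have "real m * \<theta> * \<delta> + V / (real m * \<theta>) \<le> real m * (\<theta> * \<delta> + b / \<theta>)"
      by (simp add: algebra_simps)
    also have "\<dots> \<le> real m * (3 / 2)"
      using that m_pos by (intro mult_left_mono) auto
    finally have "w \<le> real m * (3 / 2)"
      by (simp only: w_def)
    then show False
      using le[folded w_def] small m_pos by (simp add: distrib_right)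
  qed
  show False
  proof (cases "L \<le> 704")
    case True
    then have t: "t = 352"
      by (simp add: t_def A_def)
    define q where "q = 1 / \<epsilon>"
    have "32 * q \<le> real m"
      using m_ge A \<epsilon> divide_right_mono[of 32 A \<epsilon>] by (simp add: q_def)
    moreover have "(10000 + (10 * K)\<^sup>2) * (7 / 10) \<le> q"
      using mult_left_mono[OF L, of "10000 + (10 * K)\<^sup>2"] C' by (simp add: q_def)
    ultimately have "(10 * K)\<^sup>2 \<le> real m"
      using zero_le_power2[of "10 * K"] by argo
    then have Km: "10 * K \<le> sqrt m"
      by (rule real_le_rsqrt)
    show False
    \<comment> \<open>At \<open>\<delta> = 1 / 2\<close> the best \<open>\<theta>\<close> is
      \<open>sqrt (b / \<delta>)\<close>, about 1.48; the value 7/5 is close enough to stay below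
      3/2.\<close>
    proof (rule contra[of "7 / 5" "11 / 10"])
      fix V assume "V \<le> (real m)\<^sup>2 + t\<^sup>2 * exp (t\<^sup>2) * (real m * sqrt m)"
      also have "t\<^sup>2 * exp (t\<^sup>2) = K"
        unfolding t K ..
      also have "K * (real m * sqrt m) \<le> sqrt m / 10 * (real m * sqrt m)"
        using Km by (intro mult_right_mono) auto
      also have "\<dots> = (real m)\<^sup>2 / 10"
        by (simp add: power2_eq_square mult.left_commute[of _ "real m"])
      finally show "V \<le> (real m)\<^sup>2 * (11 / 10)"
        by simp
    qed (use \<delta> in auto)
  next
    case False
    then have t: "t = L / 2"
      by (simp add: t_def A_def)
    have \<delta>_eq: "\<delta> = exp (- L\<^sup>2)"
      using \<delta> by (simp add: Lsq ln_div)
    have "704 * 704 \<le> L * L"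
      using False by (intro mult_mono) auto
    then have L4: "4 \<le> L\<^sup>2"
      by (simp add: power2_eq_square)
    have exp_le: "exp (- y) \<le> 1 / 2" if "1 \<le> y" for y :: real
    proof -
      have "2 \<le> exp y"
        using exp_ge_add_one_self[of y] that by linarith
      then show ?thesis
        by (simp add: exp_minus field_simps)
    qed
    show False
    \<comment> \<open>Here \<open>\<theta>\<close> is \<open>1 / sqrt \<delta>\<close>. As
      \<open>t = L / 2\<close>, the second moment bound \<open>exp (L\<^sup>2 / 4)\<close> is
      smaller than \<open>\<theta>\<close>, and both terms are at most 1/2.\<close>
    proof (rule contra[of "exp (L\<^sup>2 / 2)" "exp (t\<^sup>2)"])
      have "exp (L\<^sup>2 / 2) * \<delta> = exp (- (L\<^sup>2 / 2))" "exp (t\<^sup>2) / exp (L\<^sup>2 / 2) = exp (- (L\<^sup>2 / 4))"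
        by (simp_all add: \<delta>_eq t power_divide flip: exp_add exp_diff)
      then show "exp (L\<^sup>2 / 2) * \<delta> + exp (t\<^sup>2) / exp (L\<^sup>2 / 2) \<le> 3 / 2"
        using exp_le[of "L\<^sup>2 / 2"] exp_le[of "L\<^sup>2 / 4"] L4 by linarith
    qed auto
  qed
qed

theorem theorem6:
  "\<exists>C>0. \<exists>c>0. \<forall>(\<epsilon>::real) (\<delta>::real) (n::nat) (r::nat) P D.
     0 < \<epsilon> \<longrightarrow> 0 < \<delta> \<longrightarrow> \<delta> \<le> 1 / 2 \<longrightarrow>
     1 / \<epsilon> \<ge> C * sqrt (ln (1 / \<delta>)) \<longrightarrow>
     int n \<ge> \<lceil>64 * (1 / \<epsilon>) * sqrt (ln (1 / \<delta>))\<rceil> \<longrightarrow>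
     l1_heavy_hitters_sketch r n \<epsilon> \<delta> P D \<longrightarrow>
     real r \<ge> c * (1 / \<epsilon>) * sqrt (ln (1 / \<delta>))"
proof -
  define K :: real where "K = 352\<^sup>2 * exp (352\<^sup>2)"
  have "0 < 10000 + (10 * K)\<^sup>2"
    using zero_le_power2[of "10 * K"] by linarith
  moreover have "(0 :: real) < 1 / 2200"
    by simp
  ultimately show ?thesis
    using rows_ge_of_heavy_hitters_sketch[OF K_def] by blast
qed

end
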